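(* Let $n\ge 2$, let $\mathcal{L}$ be an $n$-Lie algebra, let $D:\wedge^{n-1}\mathcal{L}\to\mathcal{L}$ be a linear map, and let $$D^\sharp:\wedge^{n-2}\mathcal{L}\to g\ell(\mathcal{L}),\qquad D^\sharp(x_1,\ldots,x_{n-2})(y):=D(x_1,\ldots,x_{n-2},y).$$ If $$[x_1,\ldots,x_{n-1},D(x_n,\ldots,x_{2n-2})]+(-1)^n[D(x_1,\ldots,x_{n-1}),x_n,\ldots,x_{2n-2}]=\sum_{k=0}^{n-2}D(x_n,\ldots,[x_1,\ldots,x_{n-1},x_{n+k}],\ldots,x_{2n-2})$$ for all $x_1,\ldots,x_{2n-2}\in\mathcal{L}$, then $D^\sharp\in\mathcal{Z}^1(\mathcal{L},g\ell(\mathcal{L}))$.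
   Context: All vector spaces are over a fixed ground field $k$; $\widehat{\phantom{x}}$ denotes omission, and $g\ell(\mathcal{L})$ is the space of linear maps $\mathcal{L}\to\mathcal{L}$. An $n$-Lie algebra is a vector space $\mathcal{L}$ with a linear map $[\,,\ldots,\,]:\wedge^n\mathcal{L}\to\mathcal{L}$ satisfying $$[x_1,\ldots,x_{n-1},[x_n,\ldots,x_{2n-1}]]=\sum_{k=0}^{n-1}[x_n,\ldots,[x_1,\ldots,x_{n-1},x_{n+k}],\ldots,x_{2n-1}]$$ for all $x_1,\ldots,x_{2n-1}\in\mathcal{L}$. The space $g\ell(\mathcal{L})$ is a representation of $\mathcal{L}$ via $\mu:\wedge^{n-1}\mathcal{L}\to g\ell(g\ell(\mathcal{L}))$, $\big(\mu(x_1,\ldots,x_{n-1})(T)\big)(z):=-T([x_1,\ldots,x_{n-1},z])$ for $T\in g\ell(\mathcal{L})$, $z\in\mathcal{L}$. For a representation $(V,\mu)$ of $\mathcal{L}$, $\mathcal{C}^1(\mathcal{L},V)=\mathrm{Hom}(\wedge^{n-2}\mathcal{L},V)$ (with $\wedge^0\mathcal{L}=k$). For $f\in\mathcal{C}^1(\mathcal{L},V)$, $x=x^1\wedge\cdots\wedge x^{n-1}\in\wedge^{n-1}\mathcal{L}$, $y=y^1\wedge\cdots\wedge y^{n-2}\in\wedge^{n-2}\mathcal{L}$, the differential is $$\delta f(x,y)=-f([x,y])+\mu(x^1,\ldots,x^{n-1})(f(y))+\sum_{i=1}^{n-1}(-1)^{i}\mu(x^i,y^1,\ldots,y^{n-2})\big(f(X^i)\big),$$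 where $X^i=x^1\wedge\cdots\wedge\widehat{x^i}\wedge\cdots\wedge x^{n-1}\in\wedge^{n-2}\mathcal{L}$ and $[x,y]=\sum_{k=1}^{n-2}y^1\wedge\cdots\wedge[x^1,\ldots,x^{n-1},y^k]\wedge\cdots\wedge y^{n-2}$. The space of $1$-cocycles is $\mathcal{Z}^1(\mathcal{L},V)=\{f\in\mathcal{C}^1(\mathcal{L},V)\mid\delta f=0\}$. *)

theory Defs
  imports Complex_Main "HOL-Library.Function_Algebras"
begin

text \<open>
  Linear maps from the exterior power \<open>\<Lambda>\<^sup>m L\<close> to a subspace \<open>W\<close> are represented, as usual, by the
  alternating \<open>m\<close>-linear maps into \<open>W\<close>: the value on \<open>x\<^sub>1 \<and> \<dots> \<and> x\<^sub>m\<close> is \<open>f [x\<^sub>1, \<dots>, x\<^sub>m]\<close>. Values on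
  lists of length other than \<open>m\<close> are irrelevant. Alternating means vanishing on lists with a
  repeated entry, which is the right notion in every characteristic. For \<open>m = 0\<close> the only
  argument is the empty list, so the maps are the elements of \<open>W\<close>, in accordance
  with \<open>\<Lambda>\<^sup>0 L = k\<close>.
\<close>

definition ext_hom ::
  "('k::field \<Rightarrow> 'v::ab_group_add \<Rightarrow> 'v) \<Rightarrow> ('k \<Rightarrow> 'w::ab_group_add \<Rightarrow> 'w)
    \<Rightarrow> nat \<Rightarrow> 'w set \<Rightarrow> ('v list \<Rightarrow> 'w) set"
  where "ext_hom s t m W = {f. \<forall>xs. length xs = m \<longrightarrow>
      f xs \<in> W \<and>
      (\<forall>i<m. Vector_Spaces.linear s t (\<lambda>u. f (xs[i := u]))) \<and>
      (\<forall>i<m. \<forall>j<m. i \<noteq> j \<and> xs ! i = xs ! j \<longrightarrow> f xs = 0)}"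

locale n_lie_algebra = vector_space scale
  for scale :: "'k::field \<Rightarrow> 'v::ab_group_add \<Rightarrow> 'v" +
  fixes n :: nat and br :: "'v list \<Rightarrow> 'v"
  assumes arity_pos: "n \<ge> 1"
    and br_ext_hom: "br \<in> ext_hom scale scale n UNIV"
    and fundamental_identity:
      "\<And>xs ys. length xs = n - 1 \<Longrightarrow> length ys = n \<Longrightarrow>
        br (xs @ [br ys]) = (\<Sum>k<n. br (ys[k := br (xs @ [ys ! k])]))"

text \<open>
  The space of all functions \<open>L \<rightarrow> L\<close> carries the pointwise vector space structure, with addition
  from \<open>HOL-Library.Function_Algebras\<close> and the scalar multiplication below; \<open>gl\<close> is the
  subspace of linear maps.
\<close>

definition pointwise_scale :: "('k \<Rightarrow> 'v \<Rightarrow> 'v) \<Rightarrow> 'k \<Rightarrow> ('a \<Rightarrow> 'v) \<Rightarrow> 'a \<Rightarrow> 'v"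
  where "pointwise_scale s c T = (\<lambda>z. s c (T z))"

lemma vector_space_pointwise_scale:
  assumes "vector_space s"
  shows "vector_space (pointwise_scale s)"
proof -
  interpret vector_space s by fact
  show ?thesis
    by unfold_locales
      (simp_all add: pointwise_scale_def fun_eq_iff scale_right_distrib scale_left_distrib)
qed

definition gl :: "('k::field \<Rightarrow> 'v::ab_group_add \<Rightarrow> 'v) \<Rightarrow> ('v \<Rightarrow> 'v) set"
  where "gl s = {T. Vector_Spaces.linear s s T}"

definition gl_action :: "('v list \<Rightarrow> 'v) \<Rightarrow> 'v list \<Rightarrow> ('v \<Rightarrow> 'v) \<Rightarrow> 'v \<Rightarrow> 'v::ab_group_add"
  where "gl_action br xs T = (\<lambda>z. - T (br (xs @ [z])))"

text \<open>
  In \<open>differential t n br \<mu> f x y\<close> the lists \<open>x\<close> and \<open>y\<close> have lengths \<open>n - 1\<close> and \<open>n - 2\<close>, and \<open>t\<close> is the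
  scalar multiplication of the coefficient space. The first sum is \<open>f\<close> applied, by linearity,
  to \<open>[x, y]\<close>. In the last one \<open>take i x @ drop (Suc i) x\<close> is \<open>x\<close> with its \<open>i\<close>-th entry omitted; since
  list positions start from 0, the sign is \<open>(-1)\<^sup>i\<^sup>+\<^sup>1\<close>.
\<close>

definition differential ::
  "('k::field \<Rightarrow> 'w::ab_group_add \<Rightarrow> 'w) \<Rightarrow> nat \<Rightarrow> ('v list \<Rightarrow> 'v) \<Rightarrow> ('v list \<Rightarrow> 'w \<Rightarrow> 'w)
    \<Rightarrow> ('v list \<Rightarrow> 'w) \<Rightarrow> 'v list \<Rightarrow> 'v list \<Rightarrow> 'w"
  where "differential t n br \<mu> f x y =
      - (\<Sum>k<n - 2. f (y[k := br (x @ [y ! k])]))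
      + \<mu> x (f y)
      + (\<Sum>i<n - 1. t ((-1) ^ Suc i) (\<mu> (x ! i # y) (f (take i x @ drop (Suc i) x))))"

definition cochains1 ::
  "('k::field \<Rightarrow> 'v::ab_group_add \<Rightarrow> 'v) \<Rightarrow> ('k \<Rightarrow> 'w::ab_group_add \<Rightarrow> 'w)
    \<Rightarrow> nat \<Rightarrow> 'w set \<Rightarrow> ('v list \<Rightarrow> 'w) set"
  where "cochains1 s t n W = ext_hom s t (n - 2) W"

definition cocycles1 ::
  "('k::field \<Rightarrow> 'v::ab_group_add \<Rightarrow> 'v) \<Rightarrow> ('k \<Rightarrow> 'w::ab_group_add \<Rightarrow> 'w)
    \<Rightarrow> nat \<Rightarrow> ('v list \<Rightarrow> 'v) \<Rightarrow> 'w set \<Rightarrow> ('v list \<Rightarrow> 'w \<Rightarrow> 'w) \<Rightarrow> ('v list \<Rightarrow> 'w) set"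
  where "cocycles1 s t n br W \<mu> = {f \<in> cochains1 s t n W.
      \<forall>x y. length x = n - 1 \<longrightarrow> length y = n - 2 \<longrightarrow> differential t n br \<mu> f x y = 0}"

definition sharp :: "('v list \<Rightarrow> 'v) \<Rightarrow> 'v list \<Rightarrow> 'v \<Rightarrow> 'v"
  where "sharp D xs = (\<lambda>y. D (xs @ [y]))"

end

theory Submission
  imports Defs
begin

text \<open>
  Evaluating \<open>\<delta>D\<^sup>\<sharp>(x, y)\<close> at \<open>z\<close> and abbreviating \<open>w = y\<^sup>1, \<dots>, y\<^sup>n\<^sup>-\<^sup>2, z\<close>, the term with the bracket
  \<open>[x, y]\<close> and the action term \<open>\<mu>(x)\<close> combine into one sum over all entries of \<open>w\<close>, so that
  \<open>\<delta>D\<^sup>\<sharp>(x, y)(z) = - \<Sum>\<^sub>k D(w\<^sub>1, \<dots>, [x, w\<^sub>k], \<dots>, w\<^sub>n\<^sub>-\<^sub>1) + \<Sum>\<^sub>i (-1)\<^sup>i D(X\<^sup>i, [x\<^sup>i, w])\<close>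
  with \<open>i\<close> counted from 0. Write \<open>E(x, w) = [x, D w] + (-1)\<^sup>n [D x, w]\<close> for the left side of the
  hypothesis on \<open>D\<close>. The first sum is \<open>E(x, w)\<close> by that hypothesis. In the second sum, moving the
  last argument of \<open>D\<close> into the gap left by \<open>x\<^sup>i\<close> and moving \<open>x\<^sup>i\<close> to the end of the bracket
  produces, together with \<open>(-1)\<^sup>i\<close>, the total sign \<open>-1\<close>, so it is minus the right side of the hypothesis with \<open>x\<close> and \<open>w\<close>
  exchanged, that is, \<open>- E(w, x)\<close>. Finally \<open>E\<close> is skew: moving an argument of the bracket past the
  other \<open>n - 1\<close> ones costs \<open>(-1)\<^sup>n\<^sup>-\<^sup>1\<close>, hence \<open>E(w, x) = - E(x, w)\<close>, and the two sums cancel.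

  All these signs come from \<open>ext_hom_move_to_end\<close>; \<open>omitted_entry_term\<close> identifies the second sum
  term by term, and \<open>bracket_defect_skew\<close> is the skewness of \<open>E\<close>. That \<open>D\<^sup>\<sharp>\<close> is a cochain with
  values in the linear maps holds because \<open>D\<close> is alternating and linear in each of its \<open>n - 1\<close>
  arguments.
\<close>

section \<open>Alternating multilinear maps on lists\<close>

lemma ext_hom_slot_linear:
  assumes "f \<in> ext_hom s t m W" "length (p @ a # q) = m"
  shows "Vector_Spaces.linear s t (\<lambda>u. f (p @ u # q))"
proof -
  have "length p < m"
    using assms(2) by simp
  then have "Vector_Spaces.linear s t (\<lambda>u. f ((p @ a # q)[length p := u]))"
    using assms unfolding ext_hom_def by blast
  then show ?thesis
    by simp
qed

lemma ext_hom_slot_add: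
  assumes "f \<in> ext_hom s t m W" "length (p @ a # q) = m"
  shows "f (p @ (a + b) # q) = f (p @ a # q) + f (p @ b # q)"
  using Vector_Spaces.linear.axioms(3)[OF ext_hom_slot_linear[OF assms]]
  by (rule module_hom.add)

lemma ext_hom_slot_scale:
  assumes "f \<in> ext_hom s t m W" "length (p @ a # q) = m"
  shows "f (p @ s c a # q) = t c (f (p @ a # q))"
  using Vector_Spaces.linear.axioms(3)[OF ext_hom_slot_linear[OF assms]]
  by (rule module_hom.scale)

lemma ext_hom_adjacent_eq_0:
  assumes "f \<in> ext_hom s t m W" "length (p @ a # a # q) = m"
  shows "f (p @ a # a # q) = 0"
proof -
  let ?xs = "p @ a # a # q"
  have "length p < m" "Suc (length p) < m" "length p \<noteq> Suc (length p)"
       "?xs ! length p = ?xs ! Suc (length p)"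
    using assms(2) by (auto simp: nth_append)
  then show ?thesis
    using assms unfolding ext_hom_def by blast
qed

text \<open>Expand the vanishing value with \<open>a + b\<close> in both positions.\<close>

lemma ext_hom_swap_adjacent:
  assumes f: "f \<in> ext_hom s t m W" and len: "length (p @ a # b # q) = m"
  shows "f (p @ a # b # q) = - f (p @ b # a # q)"
proof -
  have second: "f (p @ u # (a + b) # q) = f (p @ u # a # q) + f (p @ u # b # q)" for u
    using ext_hom_slot_add[OF f, of "p @ [u]" a q b] len by simp
  have "0 = f (p @ (a + b) # (a + b) # q)"
    using ext_hom_adjacent_eq_0[OF f, of p "a + b" q] len by simp
  also have "\<dots> = f (p @ a # (a + b) # q) + f (p @ b # (a + b) # q)"
    using ext_hom_slot_add[OF f, of p a "(a + b) # q" b] len by simp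
  also have "\<dots> = f (p @ a # b # q) + f (p @ b # a # q)"
    using len by (simp add: second ext_hom_adjacent_eq_0[OF f])
  finally show ?thesis
    by (simp add: eq_neg_iff_add_eq_0)
qed

text \<open>A cyclic shift of the last \<open>length q + 1\<close> arguments is a product of \<open>length q\<close> adjacent
  transpositions.\<close>

lemma ext_hom_move_to_end:
  assumes "vector_space t"
    and "f \<in> ext_hom s t m W" "length (p @ a # q) = m"
  shows "f (p @ a # q) = t ((-1) ^ length q) (f (p @ q @ [a]))"
proof -
  interpret vector_space t by fact
  show ?thesis
    using assms(3)
  proof (induction q arbitrary: p)
    case Nil
    then show ?case by simp
  next
    case (Cons b q)
    have "f (p @ a # b # q) = - f ((p @ [b]) @ a # q)"
      using ext_hom_swap_adjacent[OF assms(2) Cons.prems] by simp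
    also have "\<dots> = - t ((-1) ^ length q) (f ((p @ [b]) @ q @ [a]))"
      using Cons.prems by (subst Cons.IH) simp_all
    finally show ?case by simp
  qed
qed

section \<open>The map \<open>D\<^sup>\<sharp>\<close> as a cochain\<close>

lemma sharp_ext_hom:
  assumes D: "D \<in> ext_hom scale scale (Suc m) UNIV"
    and vs: "vector_space scale"
  shows "sharp D \<in> ext_hom scale (pointwise_scale scale) m (gl scale)"
proof -
  have "sharp D xs \<in> gl scale" if "length xs = m" for xs
    using ext_hom_slot_linear[OF D, of xs undefined "[]"] that by (simp add: gl_def sharp_def)
  moreover have "Vector_Spaces.linear scale (pointwise_scale scale) (\<lambda>u. sharp D (xs[i := u]))"
    if len: "length xs = m" and i: "i < m" for xs i
  proof -
    let ?p = "take i xs" and ?q = "\<lambda>z. drop (Suc i) xs @ [z]"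
    have upd: "xs[i := u] @ [z] = ?p @ u # ?q z" for u z
      using len i by (simp add: upd_conv_take_nth_drop)
    have slot_len: "length (?p @ u # ?q z) = Suc m" for u z
      using len i by simp
    have "sharp D (xs[i := u + v]) = sharp D (xs[i := u]) + sharp D (xs[i := v])" for u v
      using ext_hom_slot_add[OF D slot_len] by (simp add: sharp_def fun_eq_iff upd)
    moreover have "sharp D (xs[i := scale c u]) = pointwise_scale scale c (sharp D (xs[i := u]))"
      for c u
      using ext_hom_slot_scale[OF D slot_len]
      by (simp add: sharp_def fun_eq_iff upd pointwise_scale_def)
    ultimately show ?thesis
      using vs vector_space_pointwise_scale[OF vs]
      by (simp add: Vector_Spaces.linear_iff)
  qed
  moreover have "sharp D xs = 0"
    if "length xs = m" "i < m" "j < m" "i \<noteq> j" "xs ! i = xs ! j" for xs i j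
  proof
    fix z
    have "length (xs @ [z]) = Suc m" "i < Suc m" "j < Suc m" "(xs @ [z]) ! i = (xs @ [z]) ! j"
      using that by (simp_all add: nth_append)
    then show "sharp D xs z = 0 z"
      using D \<open>i \<noteq> j\<close> unfolding ext_hom_def sharp_def zero_fun_def by blast
  qed
  ultimately show ?thesis
    unfolding ext_hom_def by blast
qed

section \<open>The cocycle condition\<close>

lemma sum_fun_apply: "(\<Sum>i\<in>A. g i) z = (\<Sum>i\<in>A. g i z)"
  by (induction A rule: infinite_finite_induct) simp_all

text \<open>
  The action on linear maps brings a minus sign into both of its occurrences in the differential.
  The one from \<open>\<mu>(x)\<close> supplies exactly the summand that the sum for \<open>[x, y]\<close> lacks.
\<close>

lemma differential_sharp_apply:
  assumes D: "D \<in> ext_hom scale scale (n - 1) UNIV"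
    and vs: "vector_space scale"
    and n: "n \<ge> 2"
    and y: "length y = n - 2"
  shows "differential (pointwise_scale scale) n br (gl_action br) (sharp D) x y z =
    - (\<Sum>k<n - 1. D ((y @ [z])[k := br (x @ [(y @ [z]) ! k])]))
    - (\<Sum>i<n - 1. scale ((-1) ^ Suc i)
        (D (take i x @ drop (Suc i) x @ [br (x ! i # y @ [z])])))"
proof -
  interpret vector_space scale by fact
  have "n - 1 = Suc (n - 2)"
    using n by simp
  \<comment> \<open>The last summand of the first sum is the action term: it changes the entry \<open>z\<close>.\<close>
  then have "(\<Sum>k<n - 1. D ((y @ [z])[k := br (x @ [(y @ [z]) ! k])])) =
      (\<Sum>k<n - 2. D (y[k := br (x @ [y ! k])] @ [z])) + D (y @ [br (x @ [z])])"
    using y by (simp add: list_update_append nth_append)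
  then show ?thesis
    by (simp add: differential_def gl_action_def sharp_def pointwise_scale_def sum_fun_apply
        fun_Compl_def sum_negf)
qed

text \<open>
  The sign is \<open>(-1)\<^sup>n\<^sup>-\<^sup>2\<^sup>-\<^sup>i\<close> for moving the bracket to the end of the arguments of \<open>D\<close>, times
  \<open>(-1)\<^sup>n\<^sup>-\<^sup>1\<close> for moving the entry \<open>x ! i\<close> to the front of the bracket.
\<close>

lemma omitted_entry_term:
  fixes scale :: "'k::field \<Rightarrow> 'v::ab_group_add \<Rightarrow> 'v"
  assumes D: "D \<in> ext_hom scale scale (n - 1) UNIV"
    and br: "br \<in> ext_hom scale scale n UNIV"
    and vs: "vector_space scale"
    and x: "length x = n - 1" and w: "length w = n - 1" and i: "i < n - 1"
  shows "D (x[i := br (w @ [x ! i])]) =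
    scale ((-1) ^ Suc i) (D (take i x @ drop (Suc i) x @ [br (x ! i # w)]))"
proof -
  interpret vector_space scale by fact
  let ?b = "br (x ! i # w)"
  have front: "?b = scale ((-1) ^ (n - 1)) (br (w @ [x ! i]))"
    using ext_hom_move_to_end[OF vs br, of "[]" "x ! i" w] w i by simp
  have to_front: "br (w @ [x ! i]) = scale ((-1) ^ (n - 1)) ?b"
    by (simp add: front)
  have "D (x[i := br (w @ [x ! i])]) = D (take i x @ scale ((-1) ^ (n - 1)) ?b # drop (Suc i) x)"
    using x i by (simp add: upd_conv_take_nth_drop to_front)
  also have "\<dots> = scale ((-1) ^ (n - 1)) (D (take i x @ ?b # drop (Suc i) x))"
    using x i by (subst ext_hom_slot_scale[OF D]) simp_all
  also have "\<dots> = scale ((-1) ^ (n - 1) * (-1) ^ (n - 1 - Suc i))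
      (D (take i x @ drop (Suc i) x @ [?b]))"
    using x i by (subst ext_hom_move_to_end[OF vs D]) simp_all
  also have "(-1 :: 'k) ^ (n - 1) * (-1) ^ (n - 1 - Suc i) = (-1) ^ Suc i"
  proof -
    obtain j where j: "n - 1 = Suc i + j"
      using that[of "n - 1 - Suc i"] i by simp
    have "(-1 :: 'k) ^ (Suc i + j) * (-1) ^ j = (-1) ^ Suc i"
      by (simp add: power_add)
    then show ?thesis
      by (simp only: j diff_add_inverse)
  qed
  finally show ?thesis .
qed

text \<open>
  For \<open>a = D x\<close> and \<open>b = D w\<close> this is the skewness \<open>E(w, x) = - E(x, w)\<close>. Both sides equal
  \<open>[w, a] - [x, b]\<close>: moving the first argument of a bracket to the end gives the sign \<open>(-1)\<^sup>n\<^sup>-\<^sup>1\<close>,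
  which together with \<open>(-1)\<^sup>n\<close> leaves \<open>-1\<close>.
\<close>

lemma bracket_defect_skew:
  fixes scale :: "'k::field \<Rightarrow> 'v::ab_group_add \<Rightarrow> 'v"
  assumes br: "br \<in> ext_hom scale scale n UNIV"
    and vs: "vector_space scale"
    and n: "n \<ge> 1"
    and x: "length x = n - 1" and w: "length w = n - 1"
  shows "br (w @ [a]) + scale ((-1) ^ n) (br (b # x)) =
    - (br (x @ [b]) + scale ((-1) ^ n) (br (a # w)))"
proof -
  interpret vector_space scale by fact
  have move: "scale ((-1) ^ n) (br (c # v)) = - br (v @ [c])" if "length v = n - 1" for c v
  proof -
    have "(-1 :: 'k) ^ n = - ((-1) ^ (n - 1))"
      using n by (cases n) simp_all
    then have sign: "(-1 :: 'k) ^ n * (-1) ^ (n - 1) = -1"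
      by simp
    have "br (c # v) = scale ((-1) ^ (n - 1)) (br (v @ [c]))"
      using ext_hom_move_to_end[OF vs br, of "[]" c v] that n by simp
    then have "scale ((-1) ^ n) (br (c # v)) = scale (-1) (br (v @ [c]))"
      by (simp only: scale_scale sign)
    then show ?thesis
      by simp
  qed
  show ?thesis
    unfolding move[OF x] move[OF w] by simp
qed

theorem proposition2p13:
  fixes scale :: "'k::field \<Rightarrow> 'v::ab_group_add \<Rightarrow> 'v"
    and n :: nat
    and br :: "'v list \<Rightarrow> 'v"
    and D :: "'v list \<Rightarrow> 'v"
  assumes "n \<ge> 2"
    and "n_lie_algebra scale n br"
    and "D \<in> ext_hom scale scale (n - 1) UNIV"
    and "\<And>xs ys. length xs = n - 1 \<Longrightarrow> length ys = n - 1 \<Longrightarrow>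
      br (xs @ [D ys]) + scale ((-1) ^ n) (br (D xs # ys)) =
      (\<Sum>k<n - 1. D (ys[k := br (xs @ [ys ! k])]))"
  shows "sharp D \<in> cocycles1 scale (pointwise_scale scale) n br (gl scale) (gl_action br)"
proof -
  interpret n_lie_algebra scale n br by fact
  note D = assms(3) and hyp = assms(4)
  have vs: "vector_space scale"
    by unfold_locales
  have "Suc (n - 2) = n - 1"
    using assms(1) by simp
  then have "sharp D \<in> cochains1 scale (pointwise_scale scale) n (gl scale)"
    using sharp_ext_hom[of D scale "n - 2"] D vs by (simp add: cochains1_def)
  moreover have "differential (pointwise_scale scale) n br (gl_action br) (sharp D) x y z = 0"
    if x: "length x = n - 1" and y: "length y = n - 2" for x y z
  proof -
    let ?w = "y @ [z]"
    have w: "length ?w = n - 1"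
      using y assms(1) by simp
    have "differential (pointwise_scale scale) n br (gl_action br) (sharp D) x y z =
        - (\<Sum>k<n - 1. D (?w[k := br (x @ [?w ! k])])) - (\<Sum>i<n - 1. D (x[i := br (?w @ [x ! i])]))"
      using differential_sharp_apply[OF D vs assms(1) y, of br x z]
        omitted_entry_term[OF D br_ext_hom vs x w] by simp
    also have "\<dots> = - (br (x @ [D ?w]) + scale ((-1) ^ n) (br (D x # ?w)))
        - (br (?w @ [D x]) + scale ((-1) ^ n) (br (D ?w # x)))"
      using hyp[OF x w] hyp[OF w x] by simp
    also have "\<dots> = 0"
      using bracket_defect_skew[OF br_ext_hom vs arity_pos x w, of "D x" "D ?w"] by simp
    finally show ?thesis .
  qed
  ultimately show ?thesis
    by (simp add: cocycles1_def fun_eq_iff)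
qed

end
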